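(* Let $-\infty<a<b<+\infty$. For any càdlàg function $f:[a;b]\to\mathbb{R}$ the functions $(0;\infty)\ni c\mapsto UTV^{c}(f,[a;b])\in[0;+\infty)$, $(0;\infty)\ni c\mapsto DTV^{c}(f,[a;b])\in[0;+\infty)$ and $(0;\infty)\ni c\mapsto TV^{c}(f,[a;b])\in[0;+\infty)$ are non-increasing, continuous, convex functions of the parameter $c$. Moreover, $\lim_{c\downarrow0}TV^{c}(f,[a;b])=TV(f,[a;b])$ and for any $c\geq\|f\|_{osc}$, $TV^{c}(f,[a;b])=0$.
   Context: Càdlàg means right-continuous with left limits. $\|f\|_{osc}=\sup_{s,u\in[a;b]}|f(s)-f(u)|$. All suprema below are over $n$ and over $a\le t_0<t_1<\ldots<t_n\le b$: $$TV(f,[a;b])=\sup\sum_{i=1}^{n}|f(t_i)-f(t_{i-1})|\in[0;+\infty],\qquad TV^{c}(f,[a;b])=\sup\sum_{i=1}^{n}\max\{|f(t_i)-f(t_{i-1})|-c,0\},$$ $$UTV^{c}(f,[a;b])=\sup\sum_{i=1}^{n}\max\{f(t_i)-f(t_{i-1})-c,0\},\qquad DTV^{c}(f,[a;b])=\sup\sum_{i=1}^{n}\max\{f(t_{i-1})-f(t_i)-c,0\}.$$ *)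

theory Defs
  imports "HOL-Analysis.Analysis"
begin

definition cadlag_on :: "real \<Rightarrow> real \<Rightarrow> (real \<Rightarrow> real) \<Rightarrow> bool" where
  "cadlag_on a b f \<longleftrightarrow>
     (\<forall>t\<in>{a..<b}. (f \<longlongrightarrow> f t) (at_right t)) \<and>
     (\<forall>t\<in>{a<..b}. \<exists>l. (f \<longlongrightarrow> l) (at_left t))"

text \<open>A partition a \<le> t 0 < \<dots> < t n \<le> b is encoded as a pair (n, t); the values of t beyond
  index n are irrelevant. It need not contain the endpoints of the interval.\<close>

definition partitions :: "real \<Rightarrow> real \<Rightarrow> (nat \<times> (nat \<Rightarrow> real)) set" where
  "partitions a b =
     {(n, t). 1 \<le> n \<and> a \<le> t 0 \<and> (\<forall>i\<in>{1..n}. t (i - 1) < t i) \<and> t n \<le> b}"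

text \<open>The suprema are taken in \<^typ>\<open>ereal\<close>, since they may be infinite.\<close>

definition TV :: "(real \<Rightarrow> real) \<Rightarrow> real \<Rightarrow> real \<Rightarrow> ereal" where
  "TV f a b = (SUP (n, t)\<in>partitions a b. ereal (\<Sum>i=1..n. \<bar>f (t i) - f (t (i - 1))\<bar>))"

definition TVc :: "real \<Rightarrow> (real \<Rightarrow> real) \<Rightarrow> real \<Rightarrow> real \<Rightarrow> ereal" where
  "TVc c f a b =
     (SUP (n, t)\<in>partitions a b. ereal (\<Sum>i=1..n. max (\<bar>f (t i) - f (t (i - 1))\<bar> - c) 0))"

definition UTVc :: "real \<Rightarrow> (real \<Rightarrow> real) \<Rightarrow> real \<Rightarrow> real \<Rightarrow> ereal" where
  "UTVc c f a b =
     (SUP (n, t)\<in>partitions a b. ereal (\<Sum>i=1..n. max (f (t i) - f (t (i - 1)) - c) 0))"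

definition DTVc :: "real \<Rightarrow> (real \<Rightarrow> real) \<Rightarrow> real \<Rightarrow> real \<Rightarrow> ereal" where
  "DTVc c f a b =
     (SUP (n, t)\<in>partitions a b. ereal (\<Sum>i=1..n. max (f (t (i - 1)) - f (t i) - c) 0))"

definition osc_norm :: "(real \<Rightarrow> real) \<Rightarrow> real \<Rightarrow> real \<Rightarrow> ereal" where
  "osc_norm f a b = (SUP (s, u)\<in>{a..b} \<times> {a..b}. ereal \<bar>f s - f u\<bar>)"

end

theory Submission
  imports Defs
begin

text \<open>For \<open>c > 0\<close>, a cadlag function oscillates by at most \<open>c\<close> on each piece of some finite
  subdivision of the interval into half-open pieces. Hence in every partition sum only boundedly many
  terms exceed the threshold \<open>c\<close>, and each is at most the oscillation; this gives finiteness.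
  Suprema of convex non-increasing functions of \<open>c\<close> are convex and non-increasing, and finite
  convex functions on an open set are continuous.\<close>

section \<open>A common form of the three truncated variations\<close>

definition excess_sum :: "(real \<Rightarrow> real \<Rightarrow> real) \<Rightarrow> real \<Rightarrow> nat \<Rightarrow> (nat \<Rightarrow> real) \<Rightarrow> real" where
  "excess_sum h c n t = (\<Sum>i=1..n. max (h (t (i - 1)) (t i) - c) 0)"

text \<open>\<open>h x y\<close> stands for the signed or absolute increment of \<open>f\<close>
  from \<open>x\<close> to \<open>y\<close>. Upward, downward and total truncated variation differ
  only in \<open>h\<close>, and the ordinary total variation is the threshold \<open>c = 0\<close>,
  so each argument is carried out once.\<close>

definition excess_variation :: "(real \<Rightarrow> real \<Rightarrow> real) \<Rightarrow> real \<Rightarrow> real \<Rightarrow> real \<Rightarrow> ereal" where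
  "excess_variation h c a b = (SUP (n, t)\<in>partitions a b. ereal (excess_sum h c n t))"

lemma UTVc_eq: "UTVc c f a b = excess_variation (\<lambda>x y. f y - f x) c a b"
  and DTVc_eq: "DTVc c f a b = excess_variation (\<lambda>x y. f x - f y) c a b"
  and TVc_eq: "TVc c f a b = excess_variation (\<lambda>x y. \<bar>f y - f x\<bar>) c a b"
  by (simp_all add: UTVc_def DTVc_def TVc_def excess_variation_def excess_sum_def)

lemma TV_eq: "TV f a b = excess_variation (\<lambda>x y. \<bar>f y - f x\<bar>) 0 a b"
  by (simp add: TV_def excess_variation_def excess_sum_def)

section \<open>Points of a partition\<close>

lemma partitions_mono:
  assumes "(n, t) \<in> partitions a b" "i \<le> j" "j \<le> n"
  shows "t i \<le> t j"
  using assms(2,3)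
proof (induction j rule: dec_induct)
  case (step j)
  have "t (Suc j - 1) < t (Suc j)"
    using assms(1) step.prems unfolding partitions_def by fastforce
  with step show ?case by simp
qed simp

lemma partitions_strict_step:
  assumes "(n, t) \<in> partitions a b" "i \<in> {1..n}"
  shows "t (i - 1) < t i"
  using assms by (auto simp: partitions_def)

lemma partitions_mem:
  assumes "(n, t) \<in> partitions a b" "i \<le> n"
  shows "t i \<in> {a..b}"
  using partitions_mono[OF assms(1), of 0 i] partitions_mono[OF assms(1), of i n] assms
  by (auto simp: partitions_def)

lemma partitions_nonempty:
  assumes "a < b"
  shows "partitions a b \<noteq> {}"
proof -
  have "(1, \<lambda>i. if i = 0 then a else b) \<in> partitions a b"
    using assms by (auto simp: partitions_def)
  then show ?thesis by blast
qed

section \<open>Dependence of sums and suprema on the threshold\<close>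

lemma excess_sum_nonneg: "0 \<le> excess_sum h c n t"
  by (auto simp: excess_sum_def intro: sum_nonneg)

lemma excess_sum_antimono: "c \<le> d \<Longrightarrow> excess_sum h d n t \<le> excess_sum h c n t"
  unfolding excess_sum_def by (intro sum_mono) auto

text \<open>Every summand is the maximum of two affine functions of the threshold, hence convex, and
  sums keep convexity.\<close>

lemma excess_sum_convex:
  assumes "0 \<le> u" "0 \<le> v" "u + v = 1"
  shows "excess_sum h (u * c + v * d) n t \<le> u * excess_sum h c n t + v * excess_sum h d n t"
proof -
  have term_le: "max (x - (u * c + v * d)) 0 \<le> u * max (x - c) 0 + v * max (x - d) 0" for x
  proof (rule max.boundedI)
    have "x = (u + v) * x"
      using assms(3) by simp
    then have "x - (u * c + v * d) = u * (x - c) + v * (x - d)"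
      by (simp add: algebra_simps)
    also have "\<dots> \<le> u * max (x - c) 0 + v * max (x - d) 0"
      using assms by (intro add_mono mult_left_mono) auto
    finally show "x - (u * c + v * d) \<le> u * max (x - c) 0 + v * max (x - d) 0" .
  qed (use assms in auto)
  show ?thesis
    unfolding excess_sum_def sum_distrib_left sum.distrib[symmetric]
    by (intro sum_mono term_le)
qed

lemma excess_variation_ge:
  "(n, t) \<in> partitions a b \<Longrightarrow> ereal (excess_sum h c n t) \<le> excess_variation h c a b"
  unfolding excess_variation_def by (rule SUP_upper2[where i = "(n, t)"]) auto

lemma excess_variation_le:
  "(\<And>n t. (n, t) \<in> partitions a b \<Longrightarrow> ereal (excess_sum h c n t) \<le> B)
    \<Longrightarrow> excess_variation h c a b \<le> B"
  unfolding excess_variation_def by (rule SUP_least) auto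

text \<open>Non-negative sums alone do not suffice: in \<open>ereal\<close> the supremum over the
  empty set is minus infinity, so a partition has to exist, which \<open>a < b\<close>
  guarantees.\<close>

lemma excess_variation_nonneg:
  assumes "a < b"
  shows "0 \<le> excess_variation h c a b"
proof -
  obtain n t where "(n, t) \<in> partitions a b"
    using partitions_nonempty[OF assms] by auto
  from excess_variation_ge[OF this, of h c] show ?thesis
    by (rule order_trans[rotated]) (simp add: excess_sum_nonneg)
qed

lemma excess_variation_antimono:
  "c \<le> d \<Longrightarrow> excess_variation h d a b \<le> excess_variation h c a b"
  by (intro excess_variation_le order_trans[OF _ excess_variation_ge])
    (auto simp: excess_sum_antimono)

text \<open>From below, one partition that is nearly optimal at threshold 0 stays so for small
  \<open>c\<close>, since its sum is continuous in \<open>c\<close>. From above, monotonicity in the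
  threshold is enough. The argument also covers an infinite limit.\<close>

lemma excess_variation_tendsto_0:
  "((\<lambda>c. excess_variation h c a b) \<longlongrightarrow> excess_variation h 0 a b) (at_right 0)"
proof (rule order_tendstoI)
  fix y assume "y < excess_variation h 0 a b"
  then obtain n t where nt: "(n, t) \<in> partitions a b" and y: "y < ereal (excess_sum h 0 n t)"
    by (auto simp: excess_variation_def less_SUP_iff)
  have "((\<lambda>c. excess_sum h c n t) \<longlongrightarrow> excess_sum h 0 n t) (at_right 0)"
    unfolding excess_sum_def by (intro tendsto_intros)
  then have "((\<lambda>c. ereal (excess_sum h c n t)) \<longlongrightarrow> ereal (excess_sum h 0 n t)) (at_right 0)"
    by simp
  from order_tendstoD(1)[OF this y]
  show "\<forall>\<^sub>F c in at_right 0. y < excess_variation h c a b"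
    by eventually_elim (rule less_le_trans[OF _ excess_variation_ge[OF nt]])
next
  fix y assume y: "excess_variation h 0 a b < y"
  show "\<forall>\<^sub>F c in at_right 0. excess_variation h c a b < y"
    using eventually_at_right_less[of "0::real"]
    by eventually_elim (rule le_less_trans[OF excess_variation_antimono y], simp)
qed

section \<open>Oscillation of cadlag functions\<close>

text \<open>On each side of \<open>x\<close> the nearby values lie within \<open>c / 2\<close> of
  one number: \<open>f x\<close> on the right, the left limit on the left. By right-continuity
  \<open>x\<close> itself belongs to the right side, whence the condition
  \<open>y < x \<longleftrightarrow> z < x\<close>.\<close>

lemma cadlag_local_oscillation:
  assumes "cadlag_on a b f" "0 < c" "x \<in> {a..b}"
  shows "\<exists>d>0. \<forall>y\<in>{a..b}. \<forall>z\<in>{a..b}.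
    \<bar>y - x\<bar> < d \<and> \<bar>z - x\<bar> < d \<and> (y < x \<longleftrightarrow> z < x) \<longrightarrow> \<bar>f z - f y\<bar> \<le> c"
proof -
  have "\<exists>d>0. \<forall>y. x \<le> y \<and> y < x + d \<and> y \<in> {a..b} \<longrightarrow> \<bar>f y - f x\<bar> < c / 2"
  proof (cases "x < b")
    case True
    then have "(f \<longlongrightarrow> f x) (at_right x)"
      using assms by (auto simp: cadlag_on_def)
    then have "\<forall>\<^sub>F y in at_right x. dist (f y) (f x) < c / 2"
      using assms(2) by (intro tendstoD) auto
    then obtain e where "e > x" "\<And>y. x < y \<Longrightarrow> y < e \<Longrightarrow> \<bar>f y - f x\<bar> < c / 2"
      by (auto simp: eventually_at_right[of x "x + 1"] dist_real_def)
    then show ?thesis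
      using assms(2) by (intro exI[of _ "e - x"]) (auto simp: le_less)
  next
    case False
    \<comment> \<open>Here \<open>x = b\<close>, so \<open>y = x\<close> is the only point to
      check.\<close>
    then show ?thesis using assms by (intro exI[of _ 1]) auto
  qed
  then obtain d1 where d1: "0 < d1"
    "\<And>y. \<lbrakk>x \<le> y; y < x + d1; y \<in> {a..b}\<rbrakk> \<Longrightarrow> \<bar>f y - f x\<bar> < c / 2" by blast
  have "\<exists>d>0. \<exists>l. \<forall>y. x - d < y \<and> y < x \<and> y \<in> {a..b} \<longrightarrow> \<bar>f y - l\<bar> < c / 2"
  proof (cases "a < x")
    case True
    then obtain l where "(f \<longlongrightarrow> l) (at_left x)"
      using assms unfolding cadlag_on_def by (metis atLeastAtMost_iff greaterThanAtMost_iff)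
    then have "\<forall>\<^sub>F y in at_left x. dist (f y) l < c / 2"
      using assms(2) by (intro tendstoD) auto
    then obtain e where "e < x" "\<And>y. e < y \<Longrightarrow> y < x \<Longrightarrow> \<bar>f y - l\<bar> < c / 2"
      by (auto simp: eventually_at_left[of "x - 1" x] dist_real_def)
    then show ?thesis
      by (intro exI[of _ "x - e"] conjI exI[of _ l]) auto
  next
    case False
    \<comment> \<open>Here \<open>x = a\<close>, so there is no point to the left and any
      \<open>l\<close> will do.\<close>
    then show ?thesis using assms by (intro exI[of _ 1]) auto
  qed
  then obtain d2 l where d2: "0 < d2"
    "\<And>y. \<lbrakk>x - d2 < y; y < x; y \<in> {a..b}\<rbrakk> \<Longrightarrow> \<bar>f y - l\<bar> < c / 2" by blast
  show ?thesis
  proof (intro exI[of _ "min d1 d2"] conjI ballI impI)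
    show "0 < min d1 d2" using d1 d2 by simp
    fix y z
    assume yz: "y \<in> {a..b}" "z \<in> {a..b}"
      and "\<bar>y - x\<bar> < min d1 d2 \<and> \<bar>z - x\<bar> < min d1 d2 \<and> (y < x \<longleftrightarrow> z < x)"
    then have near: "\<bar>y - x\<bar> < d1" "\<bar>y - x\<bar> < d2" "\<bar>z - x\<bar> < d1" "\<bar>z - x\<bar> < d2"
      and side: "y < x \<longleftrightarrow> z < x" by auto
    show "\<bar>f z - f y\<bar> \<le> c"
    proof (cases "y < x")
      case True
      then have "\<bar>f y - l\<bar> < c / 2" "\<bar>f z - l\<bar> < c / 2"
        using d2(2)[of y] d2(2)[of z] yz near side by auto
      then show ?thesis by linarith
    next
      case False
      then have "\<bar>f y - f x\<bar> < c / 2" "\<bar>f z - f x\<bar> < c / 2"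
        using d1(2)[of y] d1(2)[of z] yz near side by auto
      then show ?thesis by linarith
    qed
  qed
qed

text \<open>\<open>S\<close> collects the cut points of a subdivision: an increment larger than
  \<open>c\<close> must cross one of them. Existence follows by Bolzano bisection, because the
  property survives gluing of adjacent intervals and holds on short intervals around each
  point.\<close>

lemma cadlag_bounded_and_subdivided:
  assumes "cadlag_on a b f" "0 < c" "a \<le> b"
  shows "\<exists>S K. finite S \<and> (\<forall>y\<in>{a..b}. \<bar>f y\<bar> \<le> K) \<and>
    (\<forall>y\<in>{a..b}. \<forall>z\<in>{a..b}. y < z \<and> c < \<bar>f z - f y\<bar> \<longrightarrow> (\<exists>s\<in>S. y < s \<and> s \<le> z))"
proof -
  \<comment> \<open>Bolzano's local condition quantifies over all short intervals around
    \<open>x\<close>, which may stick out of \<open>{a..b}\<close>; hence the intersections.\<close>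
  define P where "P u v \<longleftrightarrow> (\<exists>S K. finite S \<and> (\<forall>y\<in>{u..v} \<inter> {a..b}. \<bar>f y\<bar> \<le> K) \<and>
    (\<forall>y\<in>{u..v} \<inter> {a..b}. \<forall>z\<in>{u..v} \<inter> {a..b}.
      y < z \<and> c < \<bar>f z - f y\<bar> \<longrightarrow> (\<exists>s\<in>S. y < s \<and> s \<le> z)))" for u v
  have "P a b"
    using assms(3)
  proof (induction rule: Bolzano)
    case (trans u v w)
    from trans(1) obtain S K where S: "finite S" "\<And>y. y \<in> {u..v} \<inter> {a..b} \<Longrightarrow> \<bar>f y\<bar> \<le> K"
      "\<And>y z. \<lbrakk>y \<in> {u..v} \<inter> {a..b}; z \<in> {u..v} \<inter> {a..b}; y < z; c < \<bar>f z - f y\<bar>\<rbrakk> \<Longrightarrow> \<exists>s\<in>S. y < s \<and> s \<le> z"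
      unfolding P_def by blast
    from trans(2) obtain T L where T: "finite T" "\<And>y. y \<in> {v..w} \<inter> {a..b} \<Longrightarrow> \<bar>f y\<bar> \<le> L"
      "\<And>y z. \<lbrakk>y \<in> {v..w} \<inter> {a..b}; z \<in> {v..w} \<inter> {a..b}; y < z; c < \<bar>f z - f y\<bar>\<rbrakk> \<Longrightarrow> \<exists>s\<in>T. y < s \<and> s \<le> z"
      unfolding P_def by blast
    show ?case
      unfolding P_def
    \<comment> \<open>The junction \<open>v\<close> becomes a cut point, to serve pairs with one
      point on either side of it.\<close>
    proof (intro exI[of _ "insert v (S \<union> T)"] exI[of _ "max K L"] conjI ballI impI)
      show "\<bar>f y\<bar> \<le> max K L" if "y \<in> {u..w} \<inter> {a..b}" for y
        using that S(2)[of y] T(2)[of y] by (cases "y \<le> v") (auto simp: le_max_iff_disj)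
      show "\<exists>s\<in>insert v (S \<union> T). y < s \<and> s \<le> z"
        if "y \<in> {u..w} \<inter> {a..b}" "z \<in> {u..w} \<inter> {a..b}" "y < z \<and> c < \<bar>f z - f y\<bar>" for y z
      proof -
        consider "y < v" "v \<le> z" | "z < v" | "v \<le> y" by linarith
        then show ?thesis
        proof cases
          case 2
          with S(3)[of y z] that show ?thesis by auto
        next
          case 3
          with T(3)[of y z] that show ?thesis by auto
        qed auto
      qed
    qed (use S T in auto)
  next
    case (local x)
    then have "x \<in> {a..b}" by simp
    then obtain d where d: "0 < d"
      "\<And>y z. \<lbrakk>y \<in> {a..b}; z \<in> {a..b}; \<bar>y - x\<bar> < d; \<bar>z - x\<bar> < d; y < x \<longleftrightarrow> z < x\<rbrakk> \<Longrightarrow> \<bar>f z - f y\<bar> \<le> c"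
      using cadlag_local_oscillation[OF assms(1,2)] by blast
    have "P u v" if uv: "u \<le> x \<and> x \<le> v \<and> v - u < d" for u v
    proof -
      \<comment> \<open>A reference point left of \<open>x\<close>: all values on that side differ
        from \<open>f p\<close> by at most \<open>c\<close>, which bounds them. If there is no such
        point, \<open>p\<close> is arbitrary and the bound by \<open>\<bar>f x\<bar> + c\<close>
        covers everything.\<close>
      define p where "p = (SOME p. p \<in> {u..<x} \<inter> {a..b})"
      have near: "\<bar>y - x\<bar> < d" if "y \<in> {u..v}" for y
        using that uv by auto
      show ?thesis
        unfolding P_def
      proof (intro exI[of _ "{x}"] exI[of _ "max (\<bar>f x\<bar> + c) (\<bar>f p\<bar> + c)"] conjI ballI impI)
        show "\<bar>f y\<bar> \<le> max (\<bar>f x\<bar> + c) (\<bar>f p\<bar> + c)" if y: "y \<in> {u..v} \<inter> {a..b}" for y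
        proof (cases "y < x")
          case True
          with y have "y \<in> {u..<x} \<inter> {a..b}" by auto
          then have "p \<in> {u..<x} \<inter> {a..b}"
            unfolding p_def by (rule someI)
          with uv have p: "p \<in> {a..b}" "p \<in> {u..v}" "p < x" by auto
          have "\<bar>f p - f y\<bar> \<le> c"
            using d(2)[of y p] near[of y] near[of p] True y p by simp
          then show ?thesis by linarith
        next
          case False
          have "\<bar>f x - f y\<bar> \<le> c"
            using d(2)[of y x] near[of y] False y \<open>x \<in> {a..b}\<close> \<open>0 < d\<close> by simp
          then show ?thesis by linarith
        qed
        show "\<exists>s\<in>{x}. y < s \<and> s \<le> z"
          if y: "y \<in> {u..v} \<inter> {a..b}" and z: "z \<in> {u..v} \<inter> {a..b}"
            and yz: "y < z \<and> c < \<bar>f z - f y\<bar>" for y z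
        proof -
          \<comment> \<open>A large increment cannot stay on one side of \<open>x\<close>, so
            \<open>y < x \<le> z\<close>.\<close>
          have "\<not> (y < x \<longleftrightarrow> z < x)"
            using d(2)[of y z] near[of y] near[of z] y z yz by auto
          with yz show ?thesis by auto
        qed
      qed simp
    qed
    with \<open>0 < d\<close> show ?case by blast
  qed
  then show ?thesis by (simp add: P_def)
qed

section \<open>Finiteness for positive thresholds\<close>

text \<open>Double counting: each non-zero term is at most \<open>2 * K\<close> and is charged to a
  cut point in its interval, and each cut point is charged at most once.\<close>

lemma excess_variation_finite:
  assumes "cadlag_on a b f" "0 < c" "a < b" and h: "\<And>x y. h x y \<le> \<bar>f y - f x\<bar>"
  shows "excess_variation h c a b < \<infinity>"
proof -
  obtain S K where S: "finite S" and K: "\<And>y. y \<in> {a..b} \<Longrightarrow> \<bar>f y\<bar> \<le> K"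
    and cut: "\<And>y z. \<lbrakk>y \<in> {a..b}; z \<in> {a..b}; y < z; c < \<bar>f z - f y\<bar>\<rbrakk> \<Longrightarrow> \<exists>s\<in>S. y < s \<and> s \<le> z"
    using cadlag_bounded_and_subdivided[OF assms(1,2)] assms(3) by (metis less_imp_le)
  have "0 \<le> K" using K[of a] assms(3) by auto
  have "excess_variation h c a b \<le> ereal (real (card S) * (2 * K))"
  proof (rule excess_variation_le)
    fix n t assume nt: "(n, t) \<in> partitions a b"
    let ?hit = "\<lambda>i s. of_bool (t (i - 1) < s \<and> s \<le> t i) :: real"
    have term_le: "max (h (t (i - 1)) (t i) - c) 0 \<le> (\<Sum>s\<in>S. ?hit i s * (2 * K))"
      if i: "i \<in> {1..n}" for i
    proof (cases "c < \<bar>f (t i) - f (t (i - 1))\<bar>")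
      case True
      have mem: "t (i - 1) \<in> {a..b}" "t i \<in> {a..b}"
        using partitions_mem[OF nt] i by auto
      obtain s where s: "s \<in> S" "t (i - 1) < s" "s \<le> t i"
        using cut[OF mem partitions_strict_step[OF nt i] True] by blast
      have "max (h (t (i - 1)) (t i) - c) 0 \<le> ?hit i s * (2 * K)"
        using h[of "t (i - 1)" "t i"] K[OF mem(1)] K[OF mem(2)] s assms(2) by auto
      also have "\<dots> \<le> (\<Sum>s\<in>S. ?hit i s * (2 * K))"
        using s S \<open>0 \<le> K\<close> by (intro member_le_sum) auto
      finally show ?thesis .
    next
      case False
      with h[of "t (i - 1)" "t i"] have "max (h (t (i - 1)) (t i) - c) 0 = 0" by auto
      also have "\<dots> \<le> (\<Sum>s\<in>S. ?hit i s * (2 * K))"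
        using \<open>0 \<le> K\<close> by (intro sum_nonneg) auto
      finally show ?thesis .
    qed
    \<comment> \<open>The intervals from \<open>t (i - 1)\<close> (excluded) to \<open>t i\<close>
      (included) are disjoint: for \<open>i < j\<close>, \<open>t i \<le> t (j - 1)\<close>.\<close>
    have hit_once: "(\<Sum>i=1..n. ?hit i s) \<le> 1" for s
    proof -
      have no: False if "i < j" "i \<in> {1..n}" "j \<in> {1..n}" "s \<le> t i" "t (j - 1) < s" for i j
        using partitions_mono[OF nt, of i "j - 1"] that by simp linarith
      have "card {i\<in>{1..n}. t (i - 1) < s \<and> s \<le> t i} \<le> Suc 0"
        unfolding card_le_Suc0_iff_eq[OF finite_subset[OF _ finite_atLeastAtMost[of 1 n]], OF Collect_restrict]
        using no by (metis (no_types, lifting) linorder_neqE_nat mem_Collect_eq)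
      moreover have "(\<Sum>i=1..n. ?hit i s) = real (card {i\<in>{1..n}. t (i - 1) < s \<and> s \<le> t i})"
        by (subst sum_of_bool_eq) (auto intro!: arg_cong[where f = card])
      ultimately show ?thesis by simp
    qed
    have "excess_sum h c n t \<le> (\<Sum>i=1..n. \<Sum>s\<in>S. ?hit i s * (2 * K))"
      unfolding excess_sum_def by (intro sum_mono term_le)
    also have "\<dots> = (\<Sum>s\<in>S. (\<Sum>i=1..n. ?hit i s) * (2 * K))"
      by (subst sum.swap) (simp add: sum_distrib_right)
    also have "\<dots> \<le> (\<Sum>s\<in>S. 1 * (2 * K))"
      using \<open>0 \<le> K\<close> by (intro sum_mono mult_right_mono hit_once) auto
    finally show "ereal (excess_sum h c n t) \<le> ereal (real (card S) * (2 * K))" by simp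
  qed
  then show ?thesis by (rule le_less_trans) simp
qed

section \<open>Monotonicity, convexity and continuity in the threshold\<close>

lemma excess_variation_antimono_convex_continuous:
  assumes "a < b" and fin: "\<And>c. 0 < c \<Longrightarrow> excess_variation h c a b < \<infinity>"
  defines "v \<equiv> \<lambda>c. real_of_ereal (excess_variation h c a b)"
  shows "antimono_on {0<..} v" "convex_on {0<..} v" "continuous_on {0<..} v"
proof -
  \<comment> \<open>Finiteness makes the passage to real values faithful;
    \<open>real_of_ereal\<close> would send an infinite value to 0.\<close>
  have v: "excess_variation h c a b = ereal (v c)" if "0 < c" for c
    using fin[OF that] excess_variation_nonneg[OF assms(1), of h c]
    by (auto simp: v_def ereal_real')
  show "antimono_on {0<..} v"
  proof (rule monotone_onI)
    fix c d :: real assume "c \<in> {0<..}" "d \<in> {0<..}" "c \<le> d"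
    with excess_variation_antimono[of c d h a b] show "v d \<le> v c"
      by (simp add: v)
  qed
  show conv: "convex_on {0<..} v"
    unfolding convex_on_def
  proof (intro conjI ballI allI impI)
    fix c d p q :: real
    assume cd: "c \<in> {0<..}" "d \<in> {0<..}" and pq: "0 \<le> p" "0 \<le> q" "p + q = 1"
    have "p *\<^sub>R c + q *\<^sub>R d \<in> {0<..}"
      using convexD[OF convex_real_interval(3)[of 0] cd pq] .
    then have pos: "0 < p * c + q * d" by simp
    \<comment> \<open>Convexity passes to the supremum: each partition sum obeys the inequality, and
      its right-hand side is bounded independently of the partition.\<close>
    have "excess_variation h (p * c + q * d) a b \<le> ereal (p * v c + q * v d)"
    proof (rule excess_variation_le)
      fix n t assume nt: "(n, t) \<in> partitions a b"
      have "excess_sum h c n t \<le> v c" "excess_sum h d n t \<le> v d"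
        using excess_variation_ge[OF nt, of h c] excess_variation_ge[OF nt, of h d] cd
        by (auto simp: v)
      then have "p * excess_sum h c n t + q * excess_sum h d n t \<le> p * v c + q * v d"
        using pq by (intro add_mono mult_left_mono) auto
      with excess_sum_convex[OF pq, of h c d n t]
      show "ereal (excess_sum h (p * c + q * d) n t) \<le> ereal (p * v c + q * v d)" by simp
    qed
    then show "v (p *\<^sub>R c + q *\<^sub>R d) \<le> p * v c + q * v d"
      using v[OF pos] by simp
  qed (rule convex_real_interval)
  show "continuous_on {0<..} v"
    \<comment> \<open>A finite convex function is continuous on an open set; openness of
      \<open>{0<..}\<close> matters here.\<close>
    by (rule convex_on_continuous[OF open_greaterThan conv])
qed

section \<open>Thresholds above the oscillation, and the final assembly\<close>

lemma TVc_eq_0_if_ge_osc_norm: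
  assumes "a < b" "osc_norm f a b \<le> ereal c"
  shows "TVc c f a b = 0"
proof -
  have osc: "\<bar>f s - f u\<bar> \<le> c" if "s \<in> {a..b}" "u \<in> {a..b}" for s u
  proof -
    have "ereal \<bar>f s - f u\<bar> \<le> osc_norm f a b"
      unfolding osc_norm_def using that by (intro SUP_upper2[where i = "(s, u)"]) auto
    with assms(2) show ?thesis using order_trans by fastforce
  qed
  have "TVc c f a b \<le> 0"
    unfolding TVc_eq
  proof (rule excess_variation_le)
    fix n t assume nt: "(n, t) \<in> partitions a b"
    have "max (\<bar>f (t i) - f (t (i - 1))\<bar> - c) 0 = 0" if "i \<in> {1..n}" for i
      using osc[OF partitions_mem[OF nt] partitions_mem[OF nt], of i "i - 1"] that by auto
    then show "ereal (excess_sum (\<lambda>x y. \<bar>f y - f x\<bar>) c n t) \<le> 0"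
      by (simp add: excess_sum_def)
  qed
  then show ?thesis
    using excess_variation_nonneg[OF assms(1)] by (auto simp: TVc_eq intro: antisym)
qed

theorem fact5p1:
  fixes a b :: real and f :: "real \<Rightarrow> real"
  assumes "a < b" and "cadlag_on a b f"
  shows "(\<forall>V \<in> {\<lambda>c. UTVc c f a b, \<lambda>c. DTVc c f a b, \<lambda>c. TVc c f a b}.
            (\<forall>c>0. 0 \<le> V c \<and> V c < \<infinity>) \<and>
            antimono_on {0<..} (\<lambda>c. real_of_ereal (V c)) \<and>
            continuous_on {0<..} (\<lambda>c. real_of_ereal (V c)) \<and>
            convex_on {0<..} (\<lambda>c. real_of_ereal (V c))) \<and>
         ((\<lambda>c. TVc c f a b) \<longlongrightarrow> TV f a b) (at_right 0) \<and>
         (\<forall>c. ereal c \<ge> osc_norm f a b \<longrightarrow> TVc c f a b = 0)"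
proof (intro conjI)
  \<comment> \<open>All three increments are dominated by \<open>\<bar>f y - f x\<bar>\<close>, so
    one statement about \<open>h\<close> gives the claims for each of them.\<close>
  have "(\<forall>c>0. 0 \<le> excess_variation h c a b \<and> excess_variation h c a b < \<infinity>) \<and>
      antimono_on {0<..} (\<lambda>c. real_of_ereal (excess_variation h c a b)) \<and>
      continuous_on {0<..} (\<lambda>c. real_of_ereal (excess_variation h c a b)) \<and>
      convex_on {0<..} (\<lambda>c. real_of_ereal (excess_variation h c a b))"
    if h: "\<And>x y. h x y \<le> \<bar>f y - f x\<bar>" for h
  proof -
    have fin: "excess_variation h c a b < \<infinity>" if "0 < c" for c
      using excess_variation_finite[OF assms(2) that assms(1) h] .
    show ?thesis
      using excess_variation_antimono_convex_continuous[OF assms(1), of h]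
        excess_variation_nonneg[OF assms(1), of h] fin by simp
  qed
  from this[of "\<lambda>x y. f y - f x"] this[of "\<lambda>x y. f x - f y"] this[of "\<lambda>x y. \<bar>f y - f x\<bar>"]
  show "\<forall>V \<in> {\<lambda>c. UTVc c f a b, \<lambda>c. DTVc c f a b, \<lambda>c. TVc c f a b}.
      (\<forall>c>0. 0 \<le> V c \<and> V c < \<infinity>) \<and>
      antimono_on {0<..} (\<lambda>c. real_of_ereal (V c)) \<and>
      continuous_on {0<..} (\<lambda>c. real_of_ereal (V c)) \<and>
      convex_on {0<..} (\<lambda>c. real_of_ereal (V c))"
    by (simp add: UTVc_eq DTVc_eq TVc_eq)
  show "((\<lambda>c. TVc c f a b) \<longlongrightarrow> TV f a b) (at_right 0)"
    unfolding TVc_eq TV_eq by (rule excess_variation_tendsto_0)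
  show "\<forall>c. ereal c \<ge> osc_norm f a b \<longrightarrow> TVc c f a b = 0"
    using TVc_eq_0_if_ge_osc_norm[OF assms(1)] by blast
qed

end
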